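(* Let $n\ge 1$, let $\mathcal{S}$ be a set, and let $f\colon \mathrm{PD}(n)\to\mathcal{S}$ be a surjective affine invariant map. Suppose that $$\bigcup_{s\in(0,\infty)}\{f(sI)\}=\mathcal{S}.$$ Then $f$ factors as $$f=b\circ H\circ\det,$$ that is, there exist a group $G$, a group homomorphism $H\colon(0,\infty)\to G$, where $(0,\infty)$ is viewed as a group under multiplication, and a bijection $b$ from the image $H((0,\infty))$ onto $\mathcal{S}$, such that $f(M)=b(H(\det(M)))$ for every $M\in\mathrm{PD}(n)$.
   Context: All matrices are over the reals. $\mathrm{PD}(n)$ denotes the set of $n\times n$ (symmetric) positive definite real matrices, $\mathrm{GL}(n)$ the group of invertible $n\times n$ real matrices, and $I$ the $n\times n$ identity matrix. A map $f\colon\mathrm{PD}(n)\to\mathcal{S}$ to an arbitrary set $\mathcal{S}$ is called affine invariant if, for all $M,N\in\mathrm{PD}(n)$ and all $A\in\mathrm{GL}(n)$, $f(M)=f(N)$ implies $f(A^{\top}MA)=f(A^{\top}NA)$. *)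

theory Defs
  imports "HOL-Analysis.Analysis" "HOL-Algebra.Group"
begin

definition PD :: "(real ^ 'n ^ 'n) set" where
  "PD = {M. transpose M = M \<and> (\<forall>x. x \<noteq> 0 \<longrightarrow> x \<bullet> (M *v x) > 0)}"

text \<open>A map on \<^const>\<open>PD\<close> is rendered as a total function of which only the values on
  \<^const>\<open>PD\<close> matter.\<close>

definition affine_invariant :: "(real ^ 'n ^ 'n \<Rightarrow> 's) \<Rightarrow> bool" where
  "affine_invariant f \<longleftrightarrow>
     (\<forall>M\<in>PD. \<forall>N\<in>PD. \<forall>A. invertible A \<longrightarrow> f M = f N \<longrightarrow>
        f (transpose A ** M ** A) = f (transpose A ** N ** A))"

definition pos_real_group :: "real monoid" where
  "pos_real_group = \<lparr>carrier = {0<..}, monoid.mult = (*), one = 1\<rparr>"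

text \<open>HOL has no existential quantification over types. Groups receiving a homomorphism
  \<open>H\<close> from \<^const>\<open>pos_real_group\<close> are therefore taken over the carrier type \<^typ>\<open>real set\<close>,
  whose elements can be the cosets of the kernel of \<open>H\<close>: up to isomorphism, every possible
  image of \<open>H\<close> occurs there.\<close>

end

theory Submission
  imports Defs "HOL-Algebra.Coset"
begin

(* The matrices A with f (A^T A) = f I form a subgroup K of GL(n) containing O(n), and by the
   hypothesis on scalar matrices every ray of GL(n) meets K. Since positive scalars are central,
   every commutator in GL(n) is a commutator of elements of K. Hence K contains the transvections
   and the diagonal matrices of determinant 1 or -1, so it contains every matrix of determinant
   1 or -1. Writing M = A^T A and rescaling A gives f M = f (det(M)^{1/n} I), and H is the
   projection of the positive reals onto the quotient by {t. f (t^{1/n} I) = f I}. *)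

section \<open>Gram factorization of positive definite matrices\<close>

lemma inner_vector_matrix_mult:
  fixes A :: "real ^ 'n ^ 'm"
  shows "x \<bullet> (y v* A) = (A *v x) \<bullet> y"
  by (metis dot_lmul_matrix inner_commute)

lemma PD_congruence:
  fixes M A :: "real ^ 'n ^ 'n"
  assumes M: "M \<in> PD" and A: "invertible A"
  shows "transpose A ** M ** A \<in> PD"
proof -
  have "A *v x \<noteq> 0" if "x \<noteq> 0" for x
    using A that by (metis invertible_left_inverse matrix_left_invertible_ker)
  moreover have "x \<bullet> ((transpose A ** M ** A) *v x) = (A *v x) \<bullet> (M *v (A *v x))" for x
    by (simp add: matrix_vector_mul_assoc[symmetric] inner_vector_matrix_mult)
  ultimately show ?thesis
    using M by (simp add: PD_def matrix_transpose_mul matrix_mul_assoc)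
qed

lemma mat_1_PD: "(mat 1 :: real ^ 'n ^ 'n) \<in> PD"
  by (simp add: PD_def)

lemma PD_gram:
  fixes A :: "real ^ 'n ^ 'n"
  assumes "invertible A"
  shows "transpose A ** A \<in> PD"
  using PD_congruence[OF mat_1_PD assms] by simp

text \<open>Gram-Schmidt for the inner product x . (M y), adding one vector at a time. The indices
  are taken from \<open>'n\<close> itself, so before each step the family is still smaller than the
  dimension.\<close>

lemma PD_orthonormal_family:
  fixes M :: "real ^ 'n ^ 'n" and T :: "'n set"
  assumes M: "M \<in> PD" and "finite T"
  shows "\<exists>v. \<forall>i\<in>T. \<forall>j\<in>T. v i \<bullet> (M *v v j) = (if i = j then 1 else 0)"
  using \<open>finite T\<close>
proof (induction T rule: finite_induct)
  case empty
  show ?case by simp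
next
  case (insert k T)
  then obtain v where v: "\<And>i j. i \<in> T \<Longrightarrow> j \<in> T \<Longrightarrow> v i \<bullet> (M *v v j) = (if i = j then 1 else 0)"
    by blast
  have sym: "x \<bullet> (M *v y) = y \<bullet> (M *v x)" for x y
    using M by (simp add: PD_def) (metis inner_commute dot_lmul_matrix transpose_matrix_vector)
  have "dim ((\<lambda>i. M *v v i) ` T) \<le> card T"
    using insert.hyps by (meson card_image_le dim_le_card' finite_imageI le_trans)
  also have "\<dots> < card (insert k T)"
    using insert.hyps by simp
  also have "\<dots> \<le> CARD('n)"
    by (simp add: card_mono)
  finally have "dim ((\<lambda>i. M *v v i) ` T) < DIM(real ^ 'n)"
    by simp
  \<comment> \<open>Orthogonality to the vectors \<open>M *v v i\<close> in the usual sense is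
    orthogonality to the \<open>v i\<close> for the form of \<open>M\<close>.\<close>
  then obtain x where x: "x \<noteq> 0" and ox: "\<And>y. y \<in> span ((\<lambda>i. M *v v i) ` T) \<Longrightarrow> orthogonal x y"
    by (rule orthogonal_to_subspace_exists) blast
  have xv: "x \<bullet> (M *v v i) = 0" if "i \<in> T" for i
    using ox[of "M *v v i"] that by (simp add: orthogonal_def span_base)
  define q where "q = x \<bullet> (M *v x)"
  have q: "q > 0"
    using M x by (simp add: PD_def q_def)
  define w where "w = (1 / sqrt q) *\<^sub>R x"
  have ww: "w \<bullet> (M *v w) = 1"
    using q by (simp add: w_def matrix_vector_mult_scaleR flip: q_def)
  have wv: "w \<bullet> (M *v v i) = 0" if "i \<in> T" for i
    using xv[OF that] by (simp add: w_def)
  have vw: "v i \<bullet> (M *v w) = 0" if "i \<in> T" for i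
    using wv[OF that] sym by metis
  show ?case
    using insert.hyps v ww wv vw by (intro exI[of _ "v(k := w)"]) auto
qed

text \<open>If the columns of \<open>B\<close> are an orthonormal basis for the form of
  \<open>M\<close>, then B^T M B = I, and the inverse of \<open>B\<close> is the required
  factor.\<close>

lemma PD_gram_factorization:
  fixes M :: "real ^ 'n ^ 'n"
  assumes "M \<in> PD"
  obtains A :: "real ^ 'n ^ 'n" where "invertible A" "M = transpose A ** A"
proof -
  obtain v :: "'n \<Rightarrow> real ^ 'n" where v: "\<And>i j. v i \<bullet> (M *v v j) = (if i = j then 1 else 0)"
    using PD_orthonormal_family[OF assms, of UNIV] by auto
  define B where "B = (\<chi> i j. v j $ i)"
  have "B *v axis j 1 = v j" for j
    by (simp add: matrix_vector_mult_basis B_def column_def vec_eq_iff)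
  then have "axis i 1 \<bullet> ((transpose B ** M ** B) *v axis j 1) = (if i = j then 1 else 0)" for i j
    by (simp add: matrix_vector_mul_assoc[symmetric] inner_vector_matrix_mult v)
  then have BMB: "transpose B ** M ** B = mat 1"
    by (simp add: matrix_vector_mult_basis inner_axis' column_def vec_eq_iff mat_def)
  then obtain A where A: "A ** B = mat 1" "B ** A = mat 1"
    by (metis matrix_left_right_inverse)
  have "transpose A ** transpose B = mat 1"
    by (metis A(2) matrix_transpose_mul transpose_mat)
  have "M = (transpose A ** transpose B) ** M ** (B ** A)"
    using A \<open>transpose A ** transpose B = mat 1\<close> by simp
  also have "\<dots> = transpose A ** (transpose B ** M ** B) ** A"
    by (simp only: matrix_mul_assoc)
  finally have "M = transpose A ** A"
    by (simp add: BMB)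
  moreover have "invertible A"
    using A by (auto simp: invertible_def)
  ultimately show thesis
    using that by blast
qed

section \<open>Subgroups of the general linear group that contain the orthogonal group\<close>

definition diagonal_matrix :: "('n \<Rightarrow> real) \<Rightarrow> real ^ 'n ^ 'n" where
  "diagonal_matrix d = (\<chi> i j. if i = j then d i else 0)"

lemma diagonal_matrix_left: "diagonal_matrix d ** B = (\<chi> i j. d i * B $ i $ j)"
  by (simp add: diagonal_matrix_def matrix_matrix_mult_def vec_eq_iff
      if_distrib[of "\<lambda>x. x * y" for y] cong: if_cong)

lemma diagonal_matrix_right: "B ** diagonal_matrix d = (\<chi> i j. B $ i $ j * d j)"
  by (simp add: diagonal_matrix_def matrix_matrix_mult_def vec_eq_iff
      if_distrib[of "\<lambda>x. y * x" for y] cong: if_cong)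

lemma diagonal_matrix_mult:
  "diagonal_matrix d ** diagonal_matrix e = diagonal_matrix (\<lambda>i. d i * e i)"
  by (simp add: diagonal_matrix_left) (simp add: diagonal_matrix_def vec_eq_iff)

lemma diagonal_matrix_1: "diagonal_matrix (\<lambda>i. 1) = mat 1"
  by (simp add: diagonal_matrix_def mat_def)

lemma transpose_diagonal_matrix: "transpose (diagonal_matrix d) = diagonal_matrix d"
  by (auto simp: diagonal_matrix_def transpose_def vec_eq_iff)

lemma det_diagonal_matrix: "det (diagonal_matrix d) = prod d UNIV"
  by (subst det_diagonal) (simp_all add: diagonal_matrix_def)

lemma orthogonal_diagonal_matrix:
  assumes "\<And>i. d i * d i = 1"
  shows "orthogonal_matrix (diagonal_matrix d)"
  by (simp add: orthogonal_matrix transpose_diagonal_matrix diagonal_matrix_mult assms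
      diagonal_matrix_1)

text \<open>The body, like that of \<open>transvection\<close> below, is literally a generator in
  \<open>induct_matrix_elementary\<close>, so the cases of that induction fold to these
  names.\<close>

definition swap_matrix :: "'n \<Rightarrow> 'n \<Rightarrow> real ^ 'n ^ 'n" where
  "swap_matrix m n = (\<chi> i j. mat 1 $ i $ Transposition.transpose m n j)"

lemma mult_swap_matrix:
  "A ** swap_matrix m n = (\<chi> i j. A $ i $ Transposition.transpose m n j)"
  by (simp add: swap_matrix_def matrix_matrix_mult_def mat_def vec_eq_iff if_distrib cong: if_cong)

lemma transpose_swap_matrix: "transpose (swap_matrix m n) = swap_matrix m n"
  by (auto simp: swap_matrix_def transpose_def mat_def vec_eq_iff)

lemma swap_matrix_involutive: "swap_matrix m n ** swap_matrix m n = mat 1"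
  by (simp add: mult_swap_matrix) (simp add: swap_matrix_def vec_eq_iff)

lemma orthogonal_swap_matrix: "orthogonal_matrix (swap_matrix m n)"
  by (simp add: orthogonal_matrix transpose_swap_matrix swap_matrix_involutive)

lemma swap_diagonal_swap:
  "swap_matrix m n ** diagonal_matrix d ** swap_matrix m n
     = diagonal_matrix (d \<circ> Transposition.transpose m n)"
proof -
  have "swap_matrix m n $ i $ Transposition.transpose m n j = (if i = j then 1 else 0)" for i j
    by (simp add: swap_matrix_def mat_def)
  then show ?thesis
    by (auto simp: mult_swap_matrix diagonal_matrix_right)
      (auto simp: diagonal_matrix_def vec_eq_iff)
qed

definition transvection :: "'n \<Rightarrow> 'n \<Rightarrow> real \<Rightarrow> real ^ 'n ^ 'n" where
  "transvection m n c = (\<chi> i j. if i = m \<and> j = n then c else of_bool (i = j))"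

lemma transvection_mult:
  assumes "m \<noteq> n"
  shows "transvection m n a ** transvection m n b = transvection m n (a + b)"
proof -
  \<comment> \<open>Left multiplication is the row operation that adds \<open>a\<close> times row
    \<open>n\<close> to row \<open>m\<close>.\<close>
  have eq: "transvection m n a ** B = (\<chi> i. if i = m then row m B + a *\<^sub>R row n B else row i B)" for B
    using assms unfolding transvection_def matrix_matrix_mult_def row_def of_bool_def
    by (auto simp: vec_eq_iff if_distrib [of "\<lambda>x. x * y" for y] sum.remove cong: if_cong)
  show ?thesis
    unfolding eq
    using assms by (auto simp: transvection_def row_def vec_eq_iff)
qed

lemma transvection_0: "m \<noteq> n \<Longrightarrow> transvection m n 0 = mat 1"
  by (auto simp: transvection_def mat_def vec_eq_iff)

text \<open>Conjugation by the reflection \<open>D\<close> negates the off-diagonal entry, so the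
  right side is the square of \<open>transvection m n (c / 2)\<close>. As \<open>D\<close> is its
  own inverse, it is also a commutator.\<close>

lemma transvection_commutator:
  assumes "m \<noteq> n" and D: "D = diagonal_matrix (\<lambda>i. if i = m then -1 else 1)"
  shows "transvection m n c = D ** transvection m n (- c / 2) ** D ** transvection m n (c / 2)"
proof -
  have "D ** transvection m n a ** D = transvection m n (- a)" for a
    using assms(1)
    by (auto simp: D diagonal_matrix_left diagonal_matrix_right transvection_def vec_eq_iff)
  then show ?thesis
    by (simp add: transvection_mult assms(1))
qed

lemma scaleR_matrix_mult_scaleR:
  fixes A B :: "real ^ 'n ^ 'n"
  shows "(s *\<^sub>R A) ** (t *\<^sub>R B) = (s * t) *\<^sub>R (A ** B)"
  by (simp add: scalar_matrix_assoc matrix_scalar_ac mult.commute flip: scalar_mult_eq_scaleR)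

section \<open>Membership of all matrices of determinant 1 or -1\<close>

text \<open>Isolates the properties of the stabilizer of f(I) from which the algebra below proceeds.
  Closure under inverses is phrased by an equation, which suits the commutator argument
  directly.\<close>

locale ray_meeting_subgroup =
  fixes K :: "(real ^ 'n ^ 'n) set"
  assumes orthogonal: "\<And>Q. orthogonal_matrix Q \<Longrightarrow> Q \<in> K"
    and mult: "\<And>A B. A \<in> K \<Longrightarrow> B \<in> K \<Longrightarrow> A ** B \<in> K"
    and inverse: "\<And>A B. A \<in> K \<Longrightarrow> A ** B = mat 1 \<Longrightarrow> B \<in> K"
    and ray: "\<And>A. invertible A \<Longrightarrow> \<exists>s>0. s *\<^sub>R A \<in> K"
begin

text \<open>Scale \<open>A\<close> and \<open>B\<close> into \<open>K\<close> by \<open>s\<close>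
  and \<open>t\<close>; their inverses then carry 1/s and 1/t, and all four scalars cancel in the
  product.\<close>

lemma commutator:
  assumes A: "A ** A' = mat 1" and B: "B ** B' = mat 1"
  shows "A ** B ** A' ** B' \<in> K"
proof -
  obtain s where s: "s > 0" "s *\<^sub>R A \<in> K"
    using ray A by (metis invertible_right_inverse)
  obtain t where t: "t > 0" "t *\<^sub>R B \<in> K"
    using ray B by (metis invertible_right_inverse)
  have "(1 / s) *\<^sub>R A' \<in> K" "(1 / t) *\<^sub>R B' \<in> K"
    using s t A B by (auto intro: inverse simp: scaleR_matrix_mult_scaleR)
  then have "(s *\<^sub>R A) ** (t *\<^sub>R B) ** ((1 / s) *\<^sub>R A') ** ((1 / t) *\<^sub>R B') \<in> K"
    using s t mult by blast
  then show ?thesis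
    using s t by (simp add: scaleR_matrix_mult_scaleR)
qed

lemma transvection_mem:
  assumes "m \<noteq> n"
  shows "transvection m n c \<in> K" "\<bar>det (transvection m n c)\<bar> = 1"
proof -
  define D :: "real ^ 'n ^ 'n" where "D = diagonal_matrix (\<lambda>i. if i = m then -1 else 1)"
  have eq: "transvection m n c = D ** transvection m n (- c / 2) ** D ** transvection m n (c / 2)"
    using assms D_def by (rule transvection_commutator)
  have D: "D ** D = mat 1"
    by (simp add: D_def diagonal_matrix_mult flip: diagonal_matrix_1 cong: if_cong)
       (simp add: if_distrib cong: if_cong)
  have E: "transvection m n (- c / 2) ** transvection m n (c / 2) = mat 1"
    by (simp add: transvection_mult transvection_0 assms)
  show "transvection m n c \<in> K"
    unfolding eq by (rule commutator[OF D E])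
  \<comment> \<open>Determinants commute, so the factors regroup into the two products
    \<open>D\<close> and \<open>E\<close> equal to the identity.\<close>
  have "det (transvection m n c)
      = det (D ** D) * det (transvection m n (- c / 2) ** transvection m n (c / 2))"
    unfolding eq by (simp add: det_mul)
  then show "\<bar>det (transvection m n c)\<bar> = 1"
    unfolding D E by simp
qed

text \<open>The commutator of the swap of \<open>i\<close> and \<open>k\<close> with the diagonal
  matrix carrying \<open>c\<close> at \<open>k\<close>: the swap moves \<open>c\<close> to
  \<open>i\<close>, and the inverse leaves 1/c at \<open>k\<close>.\<close>

lemma diagonal_pair_mem:
  assumes "i \<noteq> k" "c \<noteq> 0"
  shows "diagonal_matrix (\<lambda>j. if j = i then c else if j = k then 1 / c else 1) \<in> K"
proof -
  let ?d = "\<lambda>c j. if j = k then c else 1 :: real"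
  have "diagonal_matrix (?d c) ** diagonal_matrix (?d (1 / c)) = mat 1"
    unfolding diagonal_matrix_mult diagonal_matrix_1[symmetric]
    using assms by (auto intro!: arg_cong[of _ _ diagonal_matrix])
  then have "swap_matrix i k ** diagonal_matrix (?d c) ** swap_matrix i k
      ** diagonal_matrix (?d (1 / c)) \<in> K"
    by (rule commutator[OF swap_matrix_involutive])
  moreover have "(\<lambda>j. (?d c \<circ> Transposition.transpose i k) j * ?d (1 / c) j)
      = (\<lambda>j. if j = i then c else if j = k then 1 / c else 1)"
    using assms by (auto simp: fun_eq_iff Transposition.transpose_def)
  ultimately show ?thesis
    unfolding swap_diagonal_swap diagonal_matrix_mult by simp
qed

text \<open>Induction on the positions \<open>T\<close> away from a pivot \<open>k\<close> where
  entries may differ from 1. Each step splits off a factor from \<open>diagonal_pair_mem\<close>;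
  finally only \<open>d k\<close> remains, it is 1 or -1, and the matrix is orthogonal.\<close>

lemma diagonal_mem_aux:
  assumes "finite T" "k \<notin> T" "\<And>i. d i \<noteq> 0" "\<And>i. i \<notin> insert k T \<Longrightarrow> d i = 1"
    "\<bar>prod d UNIV\<bar> = 1"
  shows "diagonal_matrix d \<in> K"
  using assms
proof (induction T arbitrary: d rule: finite_induct)
  case empty
  have "prod d UNIV = d k * prod d (UNIV - {k})"
    by (simp add: prod.remove)
  also have "prod d (UNIV - {k}) = 1"
    by (rule prod.neutral) (use empty in auto)
  finally have "\<bar>d k\<bar> = 1"
    using empty by simp
  then have "d i * d i = 1" for i
    using empty by (cases "i = k") (auto simp: abs_if split: if_splits)
  then show ?case
    by (rule orthogonal[OF orthogonal_diagonal_matrix])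
next
  case (insert i T)
  then have "k \<noteq> i" by auto
  let ?p = "\<lambda>j. if j = i then d i else if j = k then 1 / d i else 1"
  \<comment> \<open>The pivot absorbs \<open>d i\<close>, and the entry 1 / d i of \<open>?p\<close>
    at \<open>k\<close> compensates for this.\<close>
  let ?e = "d(i := 1, k := d k * d i)"
  have dec: "d = (\<lambda>j. ?p j * ?e j)"
    using insert.prems \<open>k \<noteq> i\<close> by (auto simp: fun_eq_iff)
  have "prod ?p UNIV = ?p i * (?p k * prod ?p (UNIV - {i} - {k}))"
    using \<open>k \<noteq> i\<close> by (subst prod.remove[of UNIV i], simp, simp, subst prod.remove[of _ k]) auto
  also have "prod ?p (UNIV - {i} - {k}) = 1"
    by (rule prod.neutral) auto
  finally have "prod ?p UNIV = 1"
    using insert.prems \<open>k \<noteq> i\<close> by simp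
  moreover have "prod d UNIV = prod ?p UNIV * prod ?e UNIV"
    by (subst dec) (rule prod.distrib)
  ultimately have "\<bar>prod ?e UNIV\<bar> = 1"
    using insert.prems by simp
  then have "diagonal_matrix ?e \<in> K"
    using insert.prems \<open>k \<noteq> i\<close> by (intro insert.IH) auto
  with diagonal_pair_mem[of i k "d i"] have "diagonal_matrix ?p ** diagonal_matrix ?e \<in> K"
    using insert.prems \<open>k \<noteq> i\<close> by (intro mult) auto
  then show ?case
    unfolding diagonal_matrix_mult dec[symmetric] .
qed

lemma diagonal_mem:
  assumes "\<bar>prod d UNIV\<bar> = 1"
  shows "diagonal_matrix d \<in> K"
proof (rule diagonal_mem_aux)
  \<comment> \<open>Any index can be the pivot; \<open>undefined\<close> picks one, and
    \<open>T\<close> consists of all the others.\<close>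
  show "finite (UNIV - {undefined :: 'n})" by simp
  show "d i \<noteq> 0" for i
    using assms by (metis UNIV_I abs_0 finite prod_zero zero_neq_one)
qed (use assms in auto)

text \<open>Determinant, absolute value and root are multiplicative, so the claim passes to products
  and is checked on elementary factors only.\<close>

lemma normalized_mem:
  fixes A :: "real ^ 'n ^ 'n"
  assumes "det A \<noteq> 0"
  shows "(1 / root CARD('n) \<bar>det A\<bar>) *\<^sub>R A \<in> K"
proof -
  \<comment> \<open>As an implication the claim makes sense for every matrix, as the induction
    requires; a matrix with a zero row satisfies it vacuously.\<close>
  have "det A \<noteq> 0 \<longrightarrow> (1 / root CARD('n) \<bar>det A\<bar>) *\<^sub>R A \<in> K"
  proof (induction A rule: induct_matrix_elementary)
    fix A B :: "real ^ 'n ^ 'n"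
    assume A: "det A \<noteq> 0 \<longrightarrow> (1 / root CARD('n) \<bar>det A\<bar>) *\<^sub>R A \<in> K"
      and B: "det B \<noteq> 0 \<longrightarrow> (1 / root CARD('n) \<bar>det B\<bar>) *\<^sub>R B \<in> K"
    show "det (A ** B) \<noteq> 0 \<longrightarrow> (1 / root CARD('n) \<bar>det (A ** B)\<bar>) *\<^sub>R (A ** B) \<in> K"
      using mult[of "(1 / root CARD('n) \<bar>det A\<bar>) *\<^sub>R A" "(1 / root CARD('n) \<bar>det B\<bar>) *\<^sub>R B"] A B
      by (auto simp: det_mul abs_mult real_root_mult scaleR_matrix_mult_scaleR)
  next
    fix A :: "real ^ 'n ^ 'n" and i
    assume "row i A = 0"
    then show "det A \<noteq> 0 \<longrightarrow> (1 / root CARD('n) \<bar>det A\<bar>) *\<^sub>R A \<in> K"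
      by (simp add: det_zero_row)
  next
    fix A :: "real ^ 'n ^ 'n"
    assume diag: "\<And>i j. i \<noteq> j \<Longrightarrow> A $ i $ j = 0"
    define r where "r = root CARD('n) \<bar>det A\<bar>"
    show "det A \<noteq> 0 \<longrightarrow> (1 / r) *\<^sub>R A \<in> K"
    proof
      assume "det A \<noteq> 0"
      then have r: "r > 0" "r ^ CARD('n) = \<bar>det A\<bar>"
        by (simp_all add: r_def)
      have eq: "(1 / r) *\<^sub>R A = diagonal_matrix (\<lambda>i. A $ i $ i / r)"
        using diag by (auto simp: diagonal_matrix_def vec_eq_iff)
      \<comment> \<open>Each of the n diagonal entries contributes one factor 1/r, and r^n is the
        absolute value of the determinant.\<close>
      have "(\<Prod>i\<in>UNIV. A $ i $ i / r) = det A / r ^ CARD('n)"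
        using diag by (simp add: det_diagonal prod_dividef)
      then have "\<bar>\<Prod>i\<in>UNIV. A $ i $ i / r\<bar> = 1"
        using r \<open>det A \<noteq> 0\<close> by simp
      then show "(1 / r) *\<^sub>R A \<in> K"
        unfolding eq by (rule diagonal_mem)
    qed
  next
    fix m n :: 'n
    have "\<bar>det (swap_matrix m n)\<bar> = 1"
      using det_orthogonal_matrix[OF orthogonal_swap_matrix, of m n] by auto
    then show "det (\<chi> i j. (mat 1 :: real ^ 'n ^ 'n) $ i $ Transposition.transpose m n j) \<noteq> 0 \<longrightarrow>
       (1 / root CARD('n) \<bar>det (\<chi> i j. (mat 1 :: real ^ 'n ^ 'n) $ i $ Transposition.transpose m n j)\<bar>) *\<^sub>R
       (\<chi> i j. (mat 1 :: real ^ 'n ^ 'n) $ i $ Transposition.transpose m n j) \<in> K"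
      using orthogonal[OF orthogonal_swap_matrix, of m n] by (simp flip: swap_matrix_def)
  next
    fix m n :: 'n and c :: real
    assume "m \<noteq> n"
    then show "det (\<chi> i j. if i = m \<and> j = n then c else of_bool (i = j)) \<noteq> 0 \<longrightarrow>
       (1 / root CARD('n) \<bar>det (\<chi> i j. if i = m \<and> j = n then c else of_bool (i = j))\<bar>) *\<^sub>R
       (\<chi> i j. if i = m \<and> j = n then c else of_bool (i = j)) \<in> K"
      using transvection_mem[of m n c] by (simp flip: transvection_def)
  qed
  with assms show ?thesis by blast
qed

end

section \<open>Affine invariant maps\<close>

lemma scaleR_PD:
  assumes "M \<in> PD" "c > 0"
  shows "c *\<^sub>R M \<in> PD"
  using assms by (auto simp: PD_def transpose_scalar simp flip: scaleR_matrix_vector_assoc)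

lemma invertible_scaleR_mat:
  fixes c :: real
  assumes "c \<noteq> 0"
  shows "invertible (c *\<^sub>R mat 1 :: real ^ 'n ^ 'n)"
  unfolding invertible_def
  using assms by (intro exI[of _ "(1 / c) *\<^sub>R mat 1"]) (simp add: scaleR_matrix_mult_scaleR)

text \<open>Scaling by \<open>c\<close> is congruence by the scalar matrix sqrt(c) I.\<close>

lemma affine_invariant_scaleR:
  fixes f :: "real ^ 'n ^ 'n \<Rightarrow> 's"
  assumes "affine_invariant f" "M \<in> PD" "N \<in> PD" "f M = f N" "c > 0"
  shows "f (c *\<^sub>R M) = f (c *\<^sub>R N)"
proof -
  let ?A = "sqrt c *\<^sub>R mat 1 :: real ^ 'n ^ 'n"
  have "transpose ?A ** X ** ?A = c *\<^sub>R X" for X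
    using \<open>c > 0\<close> scaleR_matrix_mult_scaleR[of "sqrt c" "mat 1" 1 X]
      scaleR_matrix_mult_scaleR[of "sqrt c" X "sqrt c" "mat 1"]
    by (simp add: transpose_scalar)
  moreover have "f (transpose ?A ** M ** ?A) = f (transpose ?A ** N ** ?A)"
    using assms invertible_scaleR_mat[of "sqrt c"] unfolding affine_invariant_def by force
  ultimately show ?thesis by simp
qed

text \<open>Closure rests on (AB)^T (AB) = B^T (A^T A) B: congruence by \<open>B\<close> turns f(A^T
  A) = f(I) into f((AB)^T (AB)) = f(B^T B).\<close>

lemma stabilizer_ray_meeting_subgroup:
  fixes f :: "real ^ 'n ^ 'n \<Rightarrow> 's"
  assumes inv: "affine_invariant f"
    and scalar: "\<And>M. M \<in> PD \<Longrightarrow> \<exists>s>0. f M = f (s *\<^sub>R mat 1)"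
  shows "ray_meeting_subgroup {A. invertible A \<and> f (transpose A ** A) = f (mat 1)}"
proof
  note cong = inv[unfolded affine_invariant_def, rule_format]
  fix A B :: "real ^ 'n ^ 'n"
  show "A \<in> {A. invertible A \<and> f (transpose A ** A) = f (mat 1)}" if "orthogonal_matrix A"
    using that by (auto simp: orthogonal_matrix_def invertible_def)
  show "A ** B \<in> {A. invertible A \<and> f (transpose A ** A) = f (mat 1)}"
    if "A \<in> {A. invertible A \<and> f (transpose A ** A) = f (mat 1)}"
      "B \<in> {A. invertible A \<and> f (transpose A ** A) = f (mat 1)}"
  proof -
    have "f (transpose B ** (transpose A ** A) ** B) = f (transpose B ** mat 1 ** B)"
      using that by (intro cong PD_gram mat_1_PD) auto
    then show ?thesis
      using that by (simp add: invertible_mult matrix_transpose_mul matrix_mul_assoc)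
  qed
  show "B \<in> {A. invertible A \<and> f (transpose A ** A) = f (mat 1)}"
    if "A \<in> {A. invertible A \<and> f (transpose A ** A) = f (mat 1)}" and AB: "A ** B = mat 1"
  proof -
    have B: "invertible B"
      using AB by (metis invertible_left_inverse)
    have "f (transpose B ** (transpose A ** A) ** B) = f (transpose B ** mat 1 ** B)"
      using that B by (intro cong PD_gram mat_1_PD) auto
    moreover have "transpose B ** (transpose A ** A) ** B = transpose (A ** B) ** (A ** B)"
      by (simp add: matrix_transpose_mul matrix_mul_assoc)
    ultimately show ?thesis
      using AB B by simp
  qed
  show "\<exists>s>0. s *\<^sub>R A \<in> {A. invertible A \<and> f (transpose A ** A) = f (mat 1)}" if A: "invertible A"
  proof -
    obtain s where s: "s > 0" "f (transpose A ** A) = f (s *\<^sub>R mat 1)"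
      using scalar[OF PD_gram[OF A]] by blast
    \<comment> \<open>Dividing \<open>A\<close> by sqrt(s) divides its Gram matrix by
      \<open>s\<close>, which brings the value of \<open>f\<close> to f(I).\<close>
    have "f ((1 / s) *\<^sub>R (transpose A ** A)) = f ((1 / s) *\<^sub>R (s *\<^sub>R mat 1))"
      using s A by (intro affine_invariant_scaleR[OF inv] PD_gram scaleR_PD mat_1_PD) auto
    moreover have "invertible ((1 / sqrt s) *\<^sub>R A)"
      using invertible_mult[OF invertible_scaleR_mat[of "1 / sqrt s"] A] s
        scaleR_matrix_mult_scaleR[of "1 / sqrt s" "mat 1" 1 A] by simp
    ultimately show ?thesis
      using s by (intro exI[of _ "1 / sqrt s"]) (simp add: transpose_scalar scaleR_matrix_mult_scaleR)
  qed
qed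

text \<open>Write M = A^T A and let r be the n-th root of |det A|. Then A/r is in the stabilizer, so
  f(M/r^2) = f(I); scaling back by r^2, the n-th root of det M, gives the claim.\<close>

lemma affine_invariant_eq_root_det:
  fixes f :: "real ^ 'n ^ 'n \<Rightarrow> 's"
  assumes inv: "affine_invariant f"
    and scalar: "\<And>M. M \<in> PD \<Longrightarrow> \<exists>s>0. f M = f (s *\<^sub>R mat 1)"
    and M: "M \<in> PD"
  shows "det M > 0" "f M = f (root CARD('n) (det M) *\<^sub>R mat 1)"
proof -
  interpret ray_meeting_subgroup "{A. invertible A \<and> f (transpose A ** A) = f (mat 1)}"
    using inv scalar by (rule stabilizer_ray_meeting_subgroup)
  obtain A :: "real ^ 'n ^ 'n" where A: "invertible A" and MA: "M = transpose A ** A"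
    using PD_gram_factorization[OF M] .
  have dA: "det A \<noteq> 0"
    using A by (simp add: invertible_det_nz)
  have dM: "det M = \<bar>det A\<bar> * \<bar>det A\<bar>"
    by (simp add: MA det_mul)
  then show "det M > 0"
    using dA by (simp add: zero_less_mult_iff linorder_neq_iff disj_commute)
  define r where "r = root CARD('n) \<bar>det A\<bar>"
  have r: "r > 0" "root CARD('n) (det M) = r * r"
    using dA by (simp_all only: r_def dM real_root_mult) simp
  have "f ((1 / (r * r)) *\<^sub>R M) = f (mat 1)"
    using normalized_mem[OF dA, folded r_def]
    by (simp add: MA transpose_scalar scaleR_matrix_mult_scaleR)
  then have "f ((r * r) *\<^sub>R ((1 / (r * r)) *\<^sub>R M)) = f ((r * r) *\<^sub>R mat 1)"
    using r by (intro affine_invariant_scaleR[OF inv] scaleR_PD M mat_1_PD) auto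
  then show "f M = f (root CARD('n) (det M) *\<^sub>R mat 1)"
    using r by simp
qed

section \<open>Factorization through a quotient of the positive reals\<close>

lemma comm_group_pos_real_group: "comm_group pos_real_group"
  by (rule comm_groupI)
     (auto simp: pos_real_group_def intro!: bexI[of _ "1 / x" for x])

lemma inv_pos_real_group:
  assumes "x > 0"
  shows "inv\<^bsub>pos_real_group\<^esub> x = 1 / x"
proof -
  interpret comm_group pos_real_group by (rule comm_group_pos_real_group)
  show ?thesis
    by (rule inv_equality) (use assms in \<open>auto simp: pos_real_group_def\<close>)
qed

theorem mainTheorem1:
  fixes f :: "real ^ 'n ^ 'n \<Rightarrow> 's" and S :: "'s set"
  assumes surj: "f ` PD = S"
    and inv: "affine_invariant f"
    and scalar: "(\<Union>s\<in>{0<..}. {f (s *\<^sub>R mat 1)}) = S"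
  shows "\<exists>(G :: real set monoid) (H :: real \<Rightarrow> real set) (b :: real set \<Rightarrow> 's).
           group G \<and> H \<in> hom pos_real_group G \<and>
           bij_betw b (H ` {0<..}) S \<and>
           (\<forall>M\<in>PD. f M = b (H (det M)))"
proof -
  have ex: "\<exists>s>0. f M = f (s *\<^sub>R mat 1)" if "M \<in> PD" for M
  proof -
    have "f M \<in> (\<Union>s\<in>{0<..}. {f (s *\<^sub>R mat 1)})"
      using that surj scalar by blast
    then show ?thesis by auto
  qed
  \<comment> \<open>For t > 0, \<open>g t\<close> is the value of \<open>f\<close> at the scalar
    matrix of determinant \<open>t\<close>.\<close>
  define g where "g t = f (root CARD('n) t *\<^sub>R mat 1)" for t
  \<comment> \<open>Equality under \<open>g\<close> is a congruence for multiplication, so the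
    fibres of \<open>g\<close> on the positive reals will be cosets.\<close>
  have g_mult: "g (c * t) = g (c * u)" if "g t = g u" "t > 0" "u > 0" "c > 0" for c t u
    using that
      affine_invariant_scaleR[OF inv, of "root CARD('n) t *\<^sub>R mat 1" "root CARD('n) u *\<^sub>R mat 1"
        "root CARD('n) c"]
    by (simp add: g_def real_root_mult scaleR_PD mat_1_PD)
  have g_iff: "g t = g u \<longleftrightarrow> g (t / u) = g 1" if "t > 0" "u > 0" for t u
    using g_mult[of t u "1 / u"] g_mult[of "t / u" 1 u] that by auto
  have g_img: "g ` {0<..} = S"
  proof -
    \<comment> \<open>The root maps the positive reals onto themselves, so \<open>g\<close> takes
      the same values as s \<mapsto> f(sI).\<close>
    have "(root CARD('n) :: real \<Rightarrow> real) ` {0<..} = {0<..}"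
    proof (intro equalityI subsetI)
      fix s :: real
      assume "s \<in> {0<..}"
      then have "s = root CARD('n) (s ^ CARD('n))" "s ^ CARD('n) \<in> {0<..}"
        by (simp_all add: real_root_power_cancel)
      then show "s \<in> root CARD('n) ` {0<..}"
        by (rule image_eqI)
    qed auto
    then have "(\<lambda>s. f (s *\<^sub>R mat 1)) ` root CARD('n) ` {0<..} = S"
      using scalar by (simp add: UNION_singleton_eq_range)
    then show ?thesis
      by (simp add: image_image g_def)
  qed
  \<comment> \<open>The fibre of \<open>g\<close> through 1, which is to become the kernel of
    \<open>H\<close>.\<close>
  define N where "N = {t. t > 0 \<and> g t = g 1}"
  interpret comm_group pos_real_group by (rule comm_group_pos_real_group)
  have "subgroup N pos_real_group"
  proof (rule subgroupI)
    show "N \<subseteq> carrier pos_real_group" "N \<noteq> {}"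
      by (auto simp: N_def pos_real_group_def intro: exI[of _ 1])
    show "inv\<^bsub>pos_real_group\<^esub> a \<in> N" if "a \<in> N" for a
      using that g_iff[of 1 a] by (auto simp: N_def inv_pos_real_group)
    show "a \<otimes>\<^bsub>pos_real_group\<^esub> b \<in> N" if "a \<in> N" "b \<in> N" for a b
      using that g_mult[of b 1 a] by (auto simp: N_def pos_real_group_def)
  qed
  then interpret normal N pos_real_group
    by (rule subgroup_imp_normal)
  define H where "H = r_coset pos_real_group N"
  \<comment> \<open>By \<open>g_iff\<close>, the coset of \<open>t\<close> is the whole fibre of
    \<open>g\<close> through \<open>t\<close>.\<close>
  have H: "H t = {u. u > 0 \<and> g u = g t}" if "t > 0" for t
  proof -
    have "u \<in> H t \<longleftrightarrow> u > 0 \<and> g u = g t" for u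
    proof
      assume "u \<in> H t"
      then show "u > 0 \<and> g u = g t"
        using that g_iff[of u t] by (auto simp: H_def r_coset_def N_def pos_real_group_def)
    next
      assume "u > 0 \<and> g u = g t"
      then have "u / t \<in> N"
        using that g_iff[of u t] by (simp add: N_def)
      then show "u \<in> H t"
        using that by (auto simp: H_def r_coset_def pos_real_group_def intro!: bexI[of _ "u / t"])
    qed
    then show ?thesis by blast
  qed
  \<comment> \<open>Evaluates \<open>g\<close> at a chosen representative; on a coset the choice is
    immaterial because \<open>g\<close> is constant there.\<close>
  define b where "b C = g (SOME t. t \<in> C)" for C
  have bH: "b (H t) = g t" if "t > 0" for t
  proof -
    have "t \<in> H t"
      unfolding H[OF that] using that by blast
    then have "(SOME u. u \<in> H t) \<in> H t"
      by (rule someI[of "\<lambda>u. u \<in> H t"])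
    then have "(SOME u. u \<in> H t) \<in> {u. u > 0 \<and> g u = g t}"
      by (simp only: H[OF that])
    then show ?thesis
      unfolding b_def by blast
  qed
  have "group (pos_real_group Mod N)"
    by (rule factorgroup_is_group)
  moreover have "H \<in> hom pos_real_group (pos_real_group Mod N)"
    unfolding H_def by (rule r_coset_hom_Mod)
  moreover have "bij_betw b (H ` {0<..}) S"
  proof (rule bij_betw_imageI)
    show "inj_on b (H ` {0<..})"
    proof (rule inj_onI; clarsimp)
      fix t u :: real
      assume "t > 0" "u > 0" "b (H t) = b (H u)"
      \<comment> \<open>Equal values of \<open>g\<close> determine the same fibre, hence the same
        coset.\<close>
      then show "H t = H u"
        using bH H by metis
    qed
    show "b ` H ` {0<..} = S"
      unfolding g_img[symmetric] by (simp add: image_image bH)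
  qed
  moreover have "f M = b (H (det M))" if "M \<in> PD" for M
    using affine_invariant_eq_root_det[OF inv ex that] by (simp add: bH g_def)
  ultimately show ?thesis by blast
qed

end
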